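(* Let $D$ be a finite directed graph and let $k$ be a positive integer. Then $D$ has directed path-width at least $k-1$ if and only if $D$ has a diblockage of order at least $k$ (that is, a diblockage of order $k'$ for some integer $k'\ge k$).
   Context: Let $D=(V,E)$ be a finite directed graph. Directed path-width. A directed path-decomposition of $D$ is a pair $(P,\mathcal V)$ consisting of a path $P$ with vertices $t_1,\dots,t_n$ in this order ($n\ge 1$) and a family $\mathcal V=(V_i)_{1\le i\le n}$ of subsets of $V$ (bags) such that: (i) $V=\bigcup_{i} V_i$; (ii) if $i<j<l$ then $V_i\cap V_l\subseteq V_j$; (iii) for every edge $(x,y)\in E$ there exist $i\le j$ with $x\in V_i$ and $y\in V_j$. Its width is $\max_i |V_i|-1$. The directed path-width of $D$ is the smallest width of a directed path-decomposition of $D$. Separations. A (directed) separation of $D$ is a pair $(A,B)$ of subsets of $V$ with $A\cup B=V$ such that there is no edge $(x,y)\in E$ with $x\in B\setminus A$ and $y\in A\setminus B$. Its order is $|A,B|:=|A\cap B|$. Let $\overrightarrow{S}_k$ be the set of separations of order $<k$. Separations are partially ordered by: $(A,B)\le (C,D')$ iff $A\subseteq C$ and $B\supseteq D'$. Diblockages. An orientation of $\overrightarrow{S}_k$ is a pair $\mathcal O=(\mathcal O^+,\mathcal O^-)$ of disjoint subsets of $\overrightarrow{S}_k$ with $\mathcal O^+\cup\mathcal O^-=\overrightarrow{S}_k$. It is consistent if: whenever $(A,B)\in\mathcal O^+$ and $(C,D')\in\overrightarrow{S}_k$ with $(C,D')\le (A,B)$, then $(C,D')\in\mathcal O^+$;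 and whenever $(A,B)\in\mathcal O^-$ and $(C,D')\in\overrightarrow{S}_k$ with $(A,B)\le (C,D')$, then $(C,D')\in\mathcal O^-$. A diblockage of order $k$ in $D$ is an orientation $\mathcal O=(\mathcal O^+,\mathcal O^-)$ of $\overrightarrow{S}_k$ such that: (1) every $(A,B)\in\overrightarrow{S}_k$ with $|A|<k$ lies in $\mathcal O^+$, and every $(A,B)\in\overrightarrow{S}_k$ with $|B|<k$ lies in $\mathcal O^-$; (2) $\mathcal O$ is consistent; (3) if $(A,B)\in\mathcal O^+$, $(C,D')\in\mathcal O^-$ and $(A,B)\le (C,D')$, then $|B\cap C|\ge k$. *)

theory Defs
  imports "Graph_Theory.Pair_Digraph"
begin

text \<open>The path with vertices \<open>t\<^sub>1, \<dots>, t\<^sub>n\<close> and its bags are encoded as the nonempty list of bags in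
  path order (indexed from 0).\<close>

definition directed_path_decomposition :: "'a pair_pre_digraph \<Rightarrow> 'a set list \<Rightarrow> bool" where
  "directed_path_decomposition G Vs \<longleftrightarrow>
     Vs \<noteq> [] \<and>
     pverts G = (\<Union>i<length Vs. Vs ! i) \<and>
     (\<forall>i j l. i < j \<and> j < l \<and> l < length Vs \<longrightarrow> Vs ! i \<inter> Vs ! l \<subseteq> Vs ! j) \<and>
     (\<forall>(x, y) \<in> parcs G. \<exists>i j. i \<le> j \<and> j < length Vs \<and> x \<in> Vs ! i \<and> y \<in> Vs ! j)"

text \<open>Widths are integers, since the digraph without vertices has width \<open>-1\<close>.\<close>

definition decomposition_width :: "'a set list \<Rightarrow> int" where
  "decomposition_width Vs = int (Max (card ` set Vs)) - 1"

definition directed_path_width :: "'a pair_pre_digraph \<Rightarrow> int" where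
  "directed_path_width G =
     (LEAST w. \<exists>Vs. directed_path_decomposition G Vs \<and> decomposition_width Vs = w)"

text \<open>For finite digraphs the minimum in this definition is attained.\<close>

lemma directed_path_width_attained:
  assumes "pair_fin_digraph G"
  shows "\<exists>Vs. directed_path_decomposition G Vs \<and> decomposition_width Vs = directed_path_width G"
    and "directed_path_decomposition G Us \<Longrightarrow> directed_path_width G \<le> decomposition_width Us"
proof -
  interpret pair_fin_digraph G by (rule assms)
  define m where "m = (LEAST n. \<exists>Vs. directed_path_decomposition G Vs \<and> Max (card ` set Vs) = n)"
  have single: "directed_path_decomposition G [pverts G]"
    unfolding directed_path_decomposition_def
    by (simp add: lessThan_Suc split_beta arc_fst_in_verts arc_snd_in_verts)
  have "\<exists>Vs. directed_path_decomposition G Vs \<and> Max (card ` set Vs) = m"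
    unfolding m_def by (rule LeastI_ex) (rule exI, rule exI, rule conjI[OF single refl])
  then obtain Ws where Ws: "directed_path_decomposition G Ws" "decomposition_width Ws = int m - 1"
    unfolding decomposition_width_def by auto
  have le: "int m - 1 \<le> decomposition_width Vs" if "directed_path_decomposition G Vs" for Vs
  proof -
    have "m \<le> Max (card ` set Vs)"
      unfolding m_def by (rule Least_le, rule exI, rule conjI[OF that refl])
    then show ?thesis
      unfolding decomposition_width_def by linarith
  qed
  have eq: "directed_path_width G = int m - 1"
    unfolding directed_path_width_def
    by (rule Least_equality) (use Ws in blast, use le in blast)
  show "\<exists>Vs. directed_path_decomposition G Vs \<and> decomposition_width Vs = directed_path_width G"
    using Ws unfolding eq by blast
  show "directed_path_width G \<le> decomposition_width Us" if "directed_path_decomposition G Us"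
    using le[OF that] unfolding eq .
qed

definition separation :: "'a pair_pre_digraph \<Rightarrow> 'a set \<times> 'a set \<Rightarrow> bool" where
  "separation G = (\<lambda>(A, B).
     A \<union> B = pverts G \<and> \<not> (\<exists>(x, y) \<in> parcs G. x \<in> B - A \<and> y \<in> A - B))"

definition separations_below :: "'a pair_pre_digraph \<Rightarrow> nat \<Rightarrow> ('a set \<times> 'a set) set" where
  "separations_below G k = {(A, B). separation G (A, B) \<and> card (A \<inter> B) < k}"

definition sep_le :: "'a set \<times> 'a set \<Rightarrow> 'a set \<times> 'a set \<Rightarrow> bool" where
  "sep_le = (\<lambda>(A, B) (C, D). A \<subseteq> C \<and> D \<subseteq> B)"

definition orientation ::
    "'a pair_pre_digraph \<Rightarrow> nat \<Rightarrow> ('a set \<times> 'a set) set \<Rightarrow> ('a set \<times> 'a set) set \<Rightarrow> bool" where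
  "orientation G k Pos Neg \<longleftrightarrow> Pos \<inter> Neg = {} \<and> Pos \<union> Neg = separations_below G k"

definition consistent ::
    "'a pair_pre_digraph \<Rightarrow> nat \<Rightarrow> ('a set \<times> 'a set) set \<Rightarrow> ('a set \<times> 'a set) set \<Rightarrow> bool" where
  "consistent G k Pos Neg \<longleftrightarrow>
     (\<forall>s \<in> Pos. \<forall>t \<in> separations_below G k. sep_le t s \<longrightarrow> t \<in> Pos) \<and>
     (\<forall>s \<in> Neg. \<forall>t \<in> separations_below G k. sep_le s t \<longrightarrow> t \<in> Neg)"

definition diblockage ::
    "'a pair_pre_digraph \<Rightarrow> nat \<Rightarrow> ('a set \<times> 'a set) set \<Rightarrow> ('a set \<times> 'a set) set \<Rightarrow> bool" where
  "diblockage G k Pos Neg \<longleftrightarrow>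
     orientation G k Pos Neg \<and>
     (\<forall>(A, B) \<in> separations_below G k.
        (card A < k \<longrightarrow> (A, B) \<in> Pos) \<and> (card B < k \<longrightarrow> (A, B) \<in> Neg)) \<and>
     consistent G k Pos Neg \<and>
     (\<forall>(A, B) \<in> Pos. \<forall>(C, D) \<in> Neg. sep_le (A, B) (C, D) \<longrightarrow> card (B \<inter> C) \<ge> k)"

end

theory Submission
  imports Defs
begin

text \<open>
  Think of searching the digraph from left to right. A sweep is a chain of separations that starts
  in \<open>({}, V)\<close> and moves from \<open>(A, B)\<close> to a larger \<open>(C, E)\<close> whenever \<open>|B \<inter> C| < k\<close>; the sets
  \<open>B \<inter> C\<close> are the bags it uses. A sweep that ends in \<open>(V, {})\<close> is the same thing as a directed
  path-decomposition with bags smaller than \<open>k\<close>, so both directions are statements about sweeps.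

  If a decomposition has bags smaller than \<open>k\<close>, its sweep leads from \<open>({}, V)\<close>, which every
  diblockage of order \<open>k' \<ge> k\<close> puts into the positive part, to \<open>(V, {})\<close>, which is negative.
  Some step passes from positive to negative, and its bag violates the third axiom
  (\<open>decomposition_no_diblockage\<close>).

  If no sweep reaches \<open>(V, {})\<close>, declare a separation positive when it lies below some separation
  that a sweep can reach. The whole difficulty is the third axiom: the set of separations below
  reachable ones must be closed under steps \<open>(A, B) \<rightarrow> (E, F)\<close> with \<open>|B \<inter> E| < k\<close>
  (\<open>below_sweepable_step\<close>). Let \<open>(A, B)\<close> lie below the reachable separation \<open>s\<close>, and let \<open>y\<close> be a
  separation of least order between \<open>(A, B)\<close> and \<open>s\<close>. Submodularity of the order and the
  minimality of \<open>y\<close> show two things: taking meets with \<open>y\<close> turns a sweep to \<open>s\<close> into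
  one to \<open>y\<close> without enlarging bags (\<open>sweepable_meet\<close>), and the join of \<open>y\<close> with \<open>(E, F)\<close> can be
  reached from \<open>y\<close> by one more step. What makes submodularity apply to bags as
  well as to orders is that, for separations \<open>(A, B) \<le> (C, E)\<close>, the pair \<open>(C, B)\<close> is itself a
  separation, and its order is the size of the bag \<open>B \<inter> C\<close>.
\<close>

section \<open>Lattice operations on separations\<close>

lemma separation_meet:
  assumes "separation G (A, B)" "separation G (C, E)"
  shows "separation G (A \<inter> C, B \<union> E)"
  using assms unfolding separation_def by blast

lemma separation_join:
  assumes "separation G (A, B)" "separation G (C, E)"
  shows "separation G (A \<union> C, B \<inter> E)"
  using assms unfolding separation_def by blast

lemma separation_between:
  assumes "separation G (A, B)" "separation G (C, E)" "A \<subseteq> C" "E \<subseteq> B"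
  shows "separation G (C, B)"
  using assms unfolding separation_def by blast

lemma separation_bot: "separation G ({}, pverts G)"
  unfolding separation_def by auto

lemma separation_top: "separation G (pverts G, {})"
  unfolding separation_def by auto

lemma separation_finite:
  assumes "pair_fin_digraph G" "separation G (A, B)"
  shows "finite A" "finite B"
proof -
  interpret pair_fin_digraph G by (rule assms)
  have "finite (A \<union> B)"
    using assms(2) unfolding separation_def by auto
  then show "finite A" "finite B" by auto
qed

lemma order_submodular:
  assumes "finite A" "finite B" "finite C" "finite E"
  shows "card ((A \<inter> C) \<inter> (B \<union> E)) + card ((A \<union> C) \<inter> (B \<inter> E)) \<le> card (A \<inter> B) + card (C \<inter> E)"
proof -
  let ?P = "(A \<inter> C) \<inter> (B \<union> E)" and ?Q = "(A \<union> C) \<inter> (B \<inter> E)"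
  have "card ?P + card ?Q = card (?P \<union> ?Q) + card (?P \<inter> ?Q)"
    using assms by (intro card_Un_Int) auto
  also have "?P \<inter> ?Q = (A \<inter> B) \<inter> (C \<inter> E)" by blast
  also have "card (?P \<union> ?Q) \<le> card ((A \<inter> B) \<union> (C \<inter> E))"
    using assms by (intro card_mono) auto
  also have "card ((A \<inter> B) \<union> (C \<inter> E)) + card ((A \<inter> B) \<inter> (C \<inter> E)) = card (A \<inter> B) + card (C \<inter> E)"
    using assms by (intro card_Un_Int[symmetric]) auto
  finally show ?thesis by simp
qed

section \<open>Sweeps\<close>

text \<open>
  For \<open>k > 0\<close> every reachable separation has order less than \<open>k\<close>, since \<open>C \<inter> E \<subseteq> B \<inter> C\<close>.
\<close>

inductive sweepable :: "'a pair_pre_digraph \<Rightarrow> nat \<Rightarrow> 'a set \<Rightarrow> 'a set \<Rightarrow> bool" for G k where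
  start: "sweepable G k {} (pverts G)"
| step: "sweepable G k A B \<Longrightarrow> separation G (C, E) \<Longrightarrow> A \<subseteq> C \<Longrightarrow> E \<subseteq> B \<Longrightarrow> card (B \<inter> C) < k
    \<Longrightarrow> sweepable G k C E"

lemma sweepable_separation:
  assumes "sweepable G k A B"
  shows "separation G (A, B)"
  using assms by cases (auto intro: separation_bot)

text \<open>
  The hypothesis on \<open>(Y, Z)\<close> says that its order cannot be lowered on the way up to its join with
  \<open>(A, B)\<close>. By submodularity, meeting with \<open>(Y, Z)\<close> then does not enlarge a bag \<open>B \<inter> C\<close> of
  the sweep, because the join of the separation \<open>(C, B)\<close> with \<open>(Y, Z)\<close> has at least the order of
  \<open>(Y, Z)\<close>. The hypothesis is stated with the join because the induction
  visits the earlier stages of the sweep, and these need not lie above \<open>(Y, Z)\<close>.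
\<close>

lemma sweepable_meet:
  assumes G: "pair_fin_digraph G"
    and "sweepable G k A B"
    and YZ: "separation G (Y, Z)"
    and "\<And>P Q. separation G (P, Q) \<Longrightarrow> Y \<subseteq> P \<Longrightarrow> Q \<subseteq> Z \<Longrightarrow> P \<subseteq> Y \<union> A \<Longrightarrow> Z \<inter> B \<subseteq> Q
      \<Longrightarrow> card (Y \<inter> Z) \<le> card (P \<inter> Q)"
  shows "sweepable G k (A \<inter> Y) (B \<union> Z)"
  using assms(2,4)
proof (induction rule: sweepable.induct)
  case start
  have "pverts G \<union> Z = pverts G"
    using YZ unfolding separation_def by auto
  then show ?case by (simp add: sweepable.start)
next
  case (step A B C E)
  have AB: "separation G (A, B)"
    using sweepable_separation[OF step.hyps(1)] .
  have CB: "separation G (C, B)"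
    using separation_between[OF AB step.hyps(2-4)] .
  have prev: "sweepable G k (A \<inter> Y) (B \<union> Z)"
  proof (rule step.IH)
    fix P Q
    assume "separation G (P, Q)" "Y \<subseteq> P" "Q \<subseteq> Z" "P \<subseteq> Y \<union> A" "Z \<inter> B \<subseteq> Q"
    then show "card (Y \<inter> Z) \<le> card (P \<inter> Q)"
      using step.hyps(3,4) by (intro step.prems) auto
  qed
  have "card (Y \<inter> Z) \<le> card ((C \<union> Y) \<inter> (B \<inter> Z))"
    using step.hyps(4) by (intro step.prems separation_join[OF CB YZ]) auto
  moreover have "card ((C \<inter> Y) \<inter> (B \<union> Z)) + card ((C \<union> Y) \<inter> (B \<inter> Z)) \<le> card (C \<inter> B) + card (Y \<inter> Z)"
    using separation_finite[OF G CB] separation_finite[OF G YZ] by (rule order_submodular)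
  ultimately have "card ((B \<union> Z) \<inter> (C \<inter> Y)) < k"
    using step.hyps(5) by (simp add: Int_commute)
  then show ?case
    using step.hyps by (intro sweepable.step[OF prev separation_meet[OF _ YZ]]) auto
qed

text \<open>
  The separation \<open>(Y, Z)\<close> of least order between \<open>(A, B)\<close> and \<open>(S, T)\<close> is again reachable.
  The step from \<open>(A, B)\<close> to \<open>(E, F)\<close> has as its bag the intersection of the sides of the
  separation \<open>(E, B)\<close>. The meet of \<open>(E, B)\<close> with \<open>(Y, Z)\<close> still lies between \<open>(A, B)\<close> and
  \<open>(S, T)\<close>, so its order is at least that of \<open>(Y, Z)\<close>, and by submodularity the order of the join
  is at most that of \<open>(E, B)\<close>. This join cuts out the bag \<open>Z \<inter> (Y \<union> E)\<close> of the step from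
  \<open>(Y, Z)\<close> to its join with \<open>(E, F)\<close>.
\<close>

lemma below_sweepable_step:
  assumes G: "pair_fin_digraph G"
    and ST: "sweepable G k S T"
    and AB: "separation G (A, B)" "A \<subseteq> S" "T \<subseteq> B"
    and EF: "separation G (E, F)" "A \<subseteq> E" "F \<subseteq> B"
    and bag: "card (B \<inter> E) < k"
  shows "\<exists>S' T'. sweepable G k S' T' \<and> E \<subseteq> S' \<and> T' \<subseteq> F"
proof -
  let ?between = "\<lambda>(P, Q). separation G (P, Q) \<and> A \<subseteq> P \<and> P \<subseteq> S \<and> T \<subseteq> Q \<and> Q \<subseteq> B"
  have "?between (A, B)" using AB by auto
  then obtain y where y: "?between y"
      "\<And>p. ?between p \<Longrightarrow> card (fst y \<inter> snd y) \<le> card (fst p \<inter> snd p)"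
    using ex_has_least_nat[of ?between "(A, B)" "\<lambda>p. card (fst p \<inter> snd p)"] by blast
  obtain Y Z where YZ_def: "y = (Y, Z)" by (cases y)
  have YZ: "separation G (Y, Z)" "A \<subseteq> Y" "Y \<subseteq> S" "T \<subseteq> Z" "Z \<subseteq> B"
    using y(1) unfolding YZ_def by auto
  have least: "card (Y \<inter> Z) \<le> card (P \<inter> Q)"
    if "separation G (P, Q)" "A \<subseteq> P" "P \<subseteq> S" "T \<subseteq> Q" "Q \<subseteq> B" for P Q
    using y(2)[of "(P, Q)"] that unfolding YZ_def by auto
  have "sweepable G k (S \<inter> Y) (T \<union> Z)"
    using YZ by (intro sweepable_meet[OF G ST YZ(1)] least) auto
  moreover have "S \<inter> Y = Y" "T \<union> Z = Z" using YZ by auto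
  ultimately have sweep: "sweepable G k Y Z" by simp
  have EB: "separation G (E, B)"
    using separation_between[OF AB(1) EF] .
  have "card (Y \<inter> Z) \<le> card ((Y \<inter> E) \<inter> (Z \<union> B))"
    using YZ EF by (intro least separation_meet[OF YZ(1) EB]) auto
  moreover have "card ((Y \<inter> E) \<inter> (Z \<union> B)) + card ((Y \<union> E) \<inter> (Z \<inter> B)) \<le> card (Y \<inter> Z) + card (E \<inter> B)"
    using separation_finite[OF G YZ(1)] separation_finite[OF G EB] by (rule order_submodular)
  moreover have "(Y \<union> E) \<inter> (Z \<inter> B) = Z \<inter> (Y \<union> E)" using YZ by auto
  ultimately have "card (Z \<inter> (Y \<union> E)) < k"
    using bag by (simp add: Int_commute)
  then have "sweepable G k (Y \<union> E) (Z \<inter> F)"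
    by (intro sweepable.step[OF sweep separation_join[OF YZ(1) EF(1)]]) auto
  then show ?thesis by blast
qed

section \<open>Complete sweeps are path-decompositions\<close>

text \<open>
  The bags of a sweep to \<open>(A, B)\<close> decompose the subdigraph on \<open>A\<close>. In addition a vertex of \<open>B\<close>,
  once it has entered a bag, stays in all later ones; this is what keeps the interval property
  when the next bag, a subset of \<open>B\<close>, is appended.
\<close>

lemma sweepable_bags:
  assumes "k > 0" and "sweepable G k A B"
  shows "\<exists>Vs. Vs \<noteq> [] \<and> (\<forall>W \<in> set Vs. card W < k) \<and> (\<Union>i<length Vs. Vs ! i) = A \<and>
     (\<forall>i j. i \<le> j \<and> j < length Vs \<longrightarrow> Vs ! i \<inter> B \<subseteq> Vs ! j) \<and>
     (\<forall>i j l. i < j \<and> j < l \<and> l < length Vs \<longrightarrow> Vs ! i \<inter> Vs ! l \<subseteq> Vs ! j) \<and>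
     (\<forall>(x, y) \<in> parcs G. x \<in> A \<and> y \<in> A \<longrightarrow>
        (\<exists>i j. i \<le> j \<and> j < length Vs \<and> x \<in> Vs ! i \<and> y \<in> Vs ! j))"
  using assms(2)
proof (induction rule: sweepable.induct)
  case start
  \<comment> \<open>An empty bag instead of no bag at all, because a decomposition has at least one.\<close>
  show ?case using \<open>k > 0\<close> by (intro exI[of _ "[{}]"]) auto
next
  case (step A B C E)
  have AB: "A \<union> B = pverts G" "\<And>x y. (x, y) \<in> parcs G \<Longrightarrow> x \<in> B - A \<Longrightarrow> y \<in> A - B \<Longrightarrow> False"
    using sweepable_separation[OF step.hyps(1)] unfolding separation_def by auto
  have CV: "C \<subseteq> pverts G" using step.hyps(2) unfolding separation_def by auto
  from step.IH obtain Vs where Vs: "Vs \<noteq> []" "\<forall>W \<in> set Vs. card W < k"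
    and un: "(\<Union>i<length Vs. Vs ! i) = A"
    and stay: "\<forall>i j. i \<le> j \<and> j < length Vs \<longrightarrow> Vs ! i \<inter> B \<subseteq> Vs ! j"
    and int: "\<forall>i j l. i < j \<and> j < l \<and> l < length Vs \<longrightarrow> Vs ! i \<inter> Vs ! l \<subseteq> Vs ! j"
    and arc: "\<forall>(x, y) \<in> parcs G. x \<in> A \<and> y \<in> A \<longrightarrow>
        (\<exists>i j. i \<le> j \<and> j < length Vs \<and> x \<in> Vs ! i \<and> y \<in> Vs ! j)"
    by (elim exE conjE) (rule that)
  let ?n = "length Vs" and ?W = "B \<inter> C"
  let ?Us = "Vs @ [?W]"
  have old: "?Us ! i = Vs ! i" if "i < ?n" for i using that by (simp add: nth_append)
  have new: "?Us ! ?n = ?W" by simp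
  have sub: "Vs ! i \<subseteq> A" if "i < ?n" for i using that un by blast
  show ?case
  proof (intro exI[of _ ?Us] conjI)
    show "?Us \<noteq> []" by simp
    show "\<forall>W \<in> set ?Us. card W < k" using Vs step.hyps(5) by auto
    have "(\<Union>i<length ?Us. ?Us ! i) = (\<Union>i<?n. Vs ! i) \<union> ?W"
      using old by (auto simp: lessThan_Suc)
    then show "(\<Union>i<length ?Us. ?Us ! i) = C"
      using un AB(1) CV step.hyps(3) by auto
    show "\<forall>i j. i \<le> j \<and> j < length ?Us \<longrightarrow> ?Us ! i \<inter> E \<subseteq> ?Us ! j"
    proof (intro allI impI)
      fix i j assume ij: "i \<le> j \<and> j < length ?Us"
      consider "j < ?n" | "i < ?n" "j = ?n" | "i = j" using ij by fastforce
      then show "?Us ! i \<inter> E \<subseteq> ?Us ! j"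
      proof cases
        case 1
        then show ?thesis using stay[rule_format, of i j] ij old[of i] old[of j] step.hyps(4) by auto
      next
        case 2
        then show ?thesis using sub[of i] old[of i] new step.hyps(3,4) by auto
      qed auto
    qed
    show "\<forall>i j l. i < j \<and> j < l \<and> l < length ?Us \<longrightarrow> ?Us ! i \<inter> ?Us ! l \<subseteq> ?Us ! j"
    proof (intro allI impI)
      fix i j l assume ijl: "i < j \<and> j < l \<and> l < length ?Us"
      consider "l < ?n" | "l = ?n" using ijl by fastforce
      then show "?Us ! i \<inter> ?Us ! l \<subseteq> ?Us ! j"
      proof cases
        case 1
        then show ?thesis using int[rule_format, of i j l] ijl old[of i] old[of j] old[of l] by auto
      next
        case 2
        then show ?thesis using stay[rule_format, of i j] ijl old[of i] old[of j] new by auto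
      qed
    qed
    show "\<forall>(x, y) \<in> parcs G. x \<in> C \<and> y \<in> C \<longrightarrow>
        (\<exists>i j. i \<le> j \<and> j < length ?Us \<and> x \<in> ?Us ! i \<and> y \<in> ?Us ! j)"
    proof (clarify)
      fix x y assume xy: "(x, y) \<in> parcs G" "x \<in> C" "y \<in> C"
      show "\<exists>i j. i \<le> j \<and> j < length ?Us \<and> x \<in> ?Us ! i \<and> y \<in> ?Us ! j"
      proof (cases "y \<in> ?W")
        case True
        have "x \<in> (\<Union>i<?n. Vs ! i) \<union> ?W" using un AB(1) CV xy by auto
        then obtain i where "i \<le> ?n" "x \<in> ?Us ! i"
          using old new by (metis UN_E Un_iff lessThan_iff less_imp_le order_refl)
        then show ?thesis using True new by (intro exI[of _ i] exI[of _ ?n]) auto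
      next
        case False
        then have "y \<in> A - B" using AB(1) CV xy by auto
        then have "x \<in> A" using AB CV xy by blast
        then obtain i j where "i \<le> j" "j < ?n" "x \<in> Vs ! i" "y \<in> Vs ! j"
          using bspec[OF arc xy(1)] \<open>y \<in> A - B\<close> by auto
        then show ?thesis using old[of i] old[of j] by (intro exI[of _ i] exI[of _ j]) auto
      qed
    qed
  qed
qed

lemma width_less_iff:
  assumes "Vs \<noteq> []"
  shows "decomposition_width Vs < int k - 1 \<longleftrightarrow> (\<forall>W \<in> set Vs. card W < k)"
  using assms unfolding decomposition_width_def by auto

lemma complete_sweep_width:
  assumes G: "pair_fin_digraph G" and "k > 0" and "sweepable G k (pverts G) {}"
  shows "directed_path_width G < int k - 1"
proof -
  interpret pair_fin_digraph G by (rule G)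
  obtain Vs where Vs: "Vs \<noteq> []" "\<forall>W \<in> set Vs. card W < k"
     "(\<Union>i<length Vs. Vs ! i) = pverts G"
     "\<forall>i j l. i < j \<and> j < l \<and> l < length Vs \<longrightarrow> Vs ! i \<inter> Vs ! l \<subseteq> Vs ! j"
     and arc: "\<forall>(x, y) \<in> parcs G. x \<in> pverts G \<and> y \<in> pverts G \<longrightarrow>
        (\<exists>i j. i \<le> j \<and> j < length Vs \<and> x \<in> Vs ! i \<and> y \<in> Vs ! j)"
    using sweepable_bags[OF assms(2,3)] by (elim exE conjE) (rule that)
  have "\<forall>(x, y) \<in> parcs G. \<exists>i j. i \<le> j \<and> j < length Vs \<and> x \<in> Vs ! i \<and> y \<in> Vs ! j"
  proof
    fix e assume e: "e \<in> parcs G"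
    show "case e of (x, y) \<Rightarrow> \<exists>i j. i \<le> j \<and> j < length Vs \<and> x \<in> Vs ! i \<and> y \<in> Vs ! j"
      using bspec[OF arc e] arc_fst_in_verts[OF e] arc_snd_in_verts[OF e]
      by (simp add: split_beta)
  qed
  with Vs have "directed_path_decomposition G Vs"
    unfolding directed_path_decomposition_def by simp
  then have "directed_path_width G \<le> decomposition_width Vs"
    by (rule directed_path_width_attained(2)[OF G])
  also have "\<dots> < int k - 1" using width_less_iff[OF Vs(1)] Vs(2) by simp
  finally show ?thesis .
qed

section \<open>Diblockages from incomplete sweeps\<close>

text \<open>
  The first axiom is a consequence of closure under steps: \<open>({}, V)\<close> has a step with bag \<open>A\<close> to
  \<open>(A, B)\<close>, and \<open>(A, B)\<close> has a step with bag \<open>B\<close> to \<open>(V, {})\<close>.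
\<close>

lemma diblockage_exists:
  assumes G: "pair_fin_digraph G" and none: "\<not> sweepable G k (pverts G) {}"
  shows "\<exists>Pos Neg. diblockage G k Pos Neg"
proof -
  let ?V = "pverts G"
  define below where "below = (\<lambda>(A, B). \<exists>S T. sweepable G k S T \<and> A \<subseteq> S \<and> T \<subseteq> B)"
  define Pos where "Pos = {s \<in> separations_below G k. below s}"
  define Neg where "Neg = separations_below G k - Pos"
  have step: "below (E, F)"
    if "below (A, B)" "separation G (A, B)" "separation G (E, F)" "A \<subseteq> E" "F \<subseteq> B" "card (B \<inter> E) < k"
    for A B E F
    using that below_sweepable_step[OF G, of k _ _ A B E F] unfolding below_def by blast
  have bot: "below ({}, ?V)"
    unfolding below_def using sweepable.start by fastforce
  have top: "\<not> below (?V, {})"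
  proof
    assume "below (?V, {})"
    then obtain S where S: "sweepable G k S {}" "?V \<subseteq> S" unfolding below_def by auto
    with sweepable_separation[OF S(1)] have "S = ?V" unfolding separation_def by auto
    with S none show False by simp
  qed
  have small: "(card A < k \<longrightarrow> (A, B) \<in> Pos) \<and> (card B < k \<longrightarrow> (A, B) \<in> Neg)"
    if AB: "(A, B) \<in> separations_below G k" for A B
  proof (intro conjI impI)
    have sep: "separation G (A, B)" using AB unfolding separations_below_def by auto
    have V: "?V \<inter> A = A" "B \<inter> ?V = B" "A \<subseteq> ?V" "B \<subseteq> ?V"
      using sep unfolding separation_def by auto
    show "(A, B) \<in> Pos" if "card A < k"
      using step[OF bot separation_bot sep] that V AB unfolding Pos_def by auto
    show "(A, B) \<in> Neg" if "card B < k"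
      using step[OF _ sep separation_top] that V AB top unfolding Neg_def Pos_def by auto
  qed
  have down: "below s" if "below t" "sep_le s t" for s t
    using that unfolding below_def sep_le_def by (cases s; cases t) fastforce
  have "diblockage G k Pos Neg"
    unfolding diblockage_def
  proof (intro conjI)
    show "orientation G k Pos Neg"
      unfolding orientation_def Neg_def Pos_def by auto
    show "\<forall>(A, B) \<in> separations_below G k.
        (card A < k \<longrightarrow> (A, B) \<in> Pos) \<and> (card B < k \<longrightarrow> (A, B) \<in> Neg)"
      using small by blast
    show "consistent G k Pos Neg"
      unfolding consistent_def Neg_def Pos_def using down by auto
    show "\<forall>(A, B) \<in> Pos. \<forall>(C, D) \<in> Neg. sep_le (A, B) (C, D) \<longrightarrow> card (B \<inter> C) \<ge> k"
    proof (clarify, rule ccontr)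
      fix A B C D
      assume "(A, B) \<in> Pos" "(C, D) \<in> Neg" "sep_le (A, B) (C, D)" "\<not> k \<le> card (B \<inter> C)"
      then show False
        using step[of A B C D]
        unfolding Pos_def Neg_def separations_below_def sep_le_def by auto
    qed
  qed
  then show ?thesis by blast
qed

section \<open>Decompositions exclude diblockages\<close>

text \<open>
  The sweep cuts the decomposition between consecutive bags, not at a bag: with
  \<open>A i\<close> the union of the first \<open>i\<close> bags and \<open>B i\<close> that of the others, \<open>B i \<inter> A (i + 1)\<close> is
  a single bag. Cutting at bags would put unions of two
  bags in its place, and these can have \<open>k\<close> or more elements.
\<close>

lemma decomposition_no_diblockage:
  assumes G: "pair_fin_digraph G" and dec: "directed_path_decomposition G Vs"
    and small: "\<forall>W \<in> set Vs. card W < k"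
  shows "\<not> diblockage G k Pos Neg"
proof
  assume dib: "diblockage G k Pos Neg"
  let ?n = "length Vs"
  define A where "A i = (\<Union>j<i. Vs ! j)" for i
  define B where "B i = (\<Union>j\<in>{i..<?n}. Vs ! j)" for i
  have ne: "Vs \<noteq> []" and V: "pverts G = (\<Union>i<?n. Vs ! i)"
    and int: "\<And>i j l. i < j \<Longrightarrow> j < l \<Longrightarrow> l < ?n \<Longrightarrow> Vs ! i \<inter> Vs ! l \<subseteq> Vs ! j"
    and arc: "\<And>x y. (x, y) \<in> parcs G \<Longrightarrow> \<exists>i j. i \<le> j \<and> j < ?n \<and> x \<in> Vs ! i \<and> y \<in> Vs ! j"
    using dec unfolding directed_path_decomposition_def by auto
  have fin: "finite (Vs ! i)" if "i < ?n" for i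
  proof -
    interpret pair_fin_digraph G by (rule G)
    show ?thesis using V that finite_verts by (metis UN_upper finite_subset lessThan_iff with_proj_simps(1))
  qed
  have card_bag: "card (Vs ! i) < k" if "i < ?n" for i
    using small that by simp
  have "k > 0" using card_bag[of 0] ne by fastforce
  have bag: "B i \<inter> A (Suc i) \<subseteq> Vs ! i" if "i < ?n" for i
  proof
    fix x assume "x \<in> B i \<inter> A (Suc i)"
    then obtain j l where jl: "j \<le> i" "x \<in> Vs ! j" "i \<le> l" "l < ?n" "x \<in> Vs ! l"
      unfolding A_def B_def by (auto simp: less_Suc_eq_le)
    then show "x \<in> Vs ! i"
      using int[of j i l] by (cases "j = i"; cases "i = l") auto
  qed
  have sep: "separation G (A i, B i)" if "i \<le> ?n" for i
  proof -
    have "{..<i} \<union> {i..<?n} = {..<?n}" using that by auto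
    then have "A i \<union> B i = pverts G"
      unfolding A_def B_def V by (metis UN_Un)
    moreover have False if xy: "(x, y) \<in> parcs G" "x \<in> B i - A i" "y \<in> A i - B i" for x y
    proof -
      obtain j l where jl: "j \<le> l" "l < ?n" "x \<in> Vs ! j" "y \<in> Vs ! l" using arc xy(1) by blast
      have "i \<le> j" using jl(3) xy(2) unfolding A_def by (meson DiffD2 UN_I lessThan_iff not_le)
      moreover have "l < i" using jl(2,4) xy(3) unfolding B_def by (meson DiffD2 UN_I atLeastLessThan_iff not_le)
      ultimately show False using jl(1) by simp
    qed
    ultimately show ?thesis unfolding separation_def by blast
  qed
  have mem: "(A i, B i) \<in> separations_below G k" if "i \<le> ?n" for i
  proof (cases "i < ?n")
    case True
    have "A i \<inter> B i \<subseteq> Vs ! i"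
      using bag[OF True] unfolding A_def by (auto simp: lessThan_Suc)
    then have "card (A i \<inter> B i) < k"
      using card_bag[OF True] card_mono[OF fin[OF True]] by (meson le_less_trans)
    then show ?thesis using sep[OF that] unfolding separations_below_def by simp
  next
    case False
    then have "B i = {}" unfolding B_def by auto
    then show ?thesis using sep[OF that] \<open>k > 0\<close> unfolding separations_below_def by simp
  qed
  have axioms: "Pos \<inter> Neg = {}" "Pos \<union> Neg = separations_below G k"
    "\<And>A B. (A, B) \<in> separations_below G k \<Longrightarrow> card A < k \<Longrightarrow> (A, B) \<in> Pos"
    "\<And>A B. (A, B) \<in> separations_below G k \<Longrightarrow> card B < k \<Longrightarrow> (A, B) \<in> Neg"
    "\<And>A B C D. (A, B) \<in> Pos \<Longrightarrow> (C, D) \<in> Neg \<Longrightarrow> sep_le (A, B) (C, D) \<Longrightarrow> card (B \<inter> C) \<ge> k"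
    using dib unfolding diblockage_def orientation_def by blast+
  have pos: "(A i, B i) \<in> Pos" if "i \<le> ?n" for i
    using that
  proof (induction i)
    case 0
    have "card (A 0) < k" using \<open>k > 0\<close> unfolding A_def by simp
    then show ?case using axioms(3) mem by blast
  next
    case (Suc i)
    have i: "i < ?n" using Suc.prems by simp
    have le: "sep_le (A i, B i) (A (Suc i), B (Suc i))"
      unfolding sep_le_def A_def B_def by fastforce
    have "card (B i \<inter> A (Suc i)) < k"
      using card_bag[OF i] card_mono[OF fin[OF i] bag[OF i]] by simp
    then have "(A (Suc i), B (Suc i)) \<notin> Neg"
      using axioms(5)[OF _ _ le] Suc.IH i by fastforce
    then show ?case using axioms(2) mem[OF Suc.prems] by blast
  qed
  have "card (B ?n) < k" using \<open>k > 0\<close> unfolding B_def by simp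
  then have "(A ?n, B ?n) \<in> Neg" using axioms(4) mem by blast
  then show False using pos[of ?n] axioms(1) by blast
qed

section \<open>Duality\<close>

theorem theorem4:
  fixes D :: "'a pair_pre_digraph" and k :: nat
  assumes "pair_fin_digraph D" and "k > 0"
  shows "directed_path_width D \<ge> int k - 1 \<longleftrightarrow>
    (\<exists>k' \<ge> k. \<exists>Pos Neg. diblockage D k' Pos Neg)"
proof
  assume "directed_path_width D \<ge> int k - 1"
  then have "\<not> sweepable D k (pverts D) {}"
    using complete_sweep_width[OF assms] by linarith
  then show "\<exists>k' \<ge> k. \<exists>Pos Neg. diblockage D k' Pos Neg"
    using diblockage_exists[OF assms(1)] by blast
next
  assume "\<exists>k' \<ge> k. \<exists>Pos Neg. diblockage D k' Pos Neg"
  then obtain k' Pos Neg where k': "k' \<ge> k" "diblockage D k' Pos Neg" by blast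
  show "directed_path_width D \<ge> int k - 1"
  proof (rule ccontr)
    assume "\<not> directed_path_width D \<ge> int k - 1"
    then obtain Vs where Vs: "directed_path_decomposition D Vs" "decomposition_width Vs < int k - 1"
      using directed_path_width_attained(1)[OF assms(1)] by fastforce
    have "Vs \<noteq> []" using Vs(1) unfolding directed_path_decomposition_def by blast
    then have "\<forall>W \<in> set Vs. card W < k" using width_less_iff[of Vs k] Vs(2) by simp
    then have "\<forall>W \<in> set Vs. card W < k'" using k'(1) by auto
    then show False using decomposition_no_diblockage[OF assms(1) Vs(1)] k'(2) by blast
  qed
qed

end
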